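(* Let $Q\in\mathrm{Gr}(k,n)$ and $X,Y\in\mathbb{T}_Q\mathrm{Gr}(k,n)$ with \[ Q=VI_{k,n-k}V^{\mathsf T},\qquad X=V\begin{bmatrix}0 & B \\ B^{\mathsf T} & 0\end{bmatrix}V^{\mathsf T},\qquad Y=V\begin{bmatrix}0 & C \\ C^{\mathsf T} & 0\end{bmatrix}V^{\mathsf T}, \] where $V\in\mathrm{O}(n)$ and $B,C\in\mathbb{R}^{k\times(n-k)}$. Let $\gamma$ be the geodesic in $\mathrm{Gr}(k,n)$ emanating from $Q$ in the direction $X$, i.e. $\gamma(0)=Q$, $\dot\gamma(0)=X$. Then the parallel transport of $Y$ along $\gamma$ is \[ Y(t)=V\exp\left(\frac t2\begin{bmatrix}0 & -B \\ B^{\mathsf T} & 0\end{bmatrix}\right)\begin{bmatrix}0 & C \\ C^{\mathsf T} & 0\end{bmatrix}\exp\left(\frac t2\begin{bmatrix}0 & B \\ -B^{\mathsf T} & 0\end{bmatrix}\right)V^{\mathsf T}. \]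
   Context: For $k\in\{1,\dots,n\}$, $\mathrm{Gr}(k,n)=\{Q\in\mathrm{O}(n):Q^{\mathsf T}=Q,\ \operatorname{tr}(Q)=2k-n\}$, an embedded submanifold of $\mathbb{R}^{n\times n}$, equipped with the Riemannian metric $\langle X,Y\rangle_Q=\operatorname{tr}(XY)$ for $X,Y\in\mathbb{T}_Q\mathrm{Gr}(k,n)$ and its Levi-Civita connection. $I_{k,n-k}=\operatorname{diag}(I_k,-I_{n-k})$. Every $Q\in\mathrm{Gr}(k,n)$ can be written $Q=VI_{k,n-k}V^{\mathsf T}$ with $V\in\mathrm{O}(n)$, and $\mathbb{T}_Q\mathrm{Gr}(k,n)=\bigl\{V\begin{bmatrix}0 & B \\ B^{\mathsf T} & 0\end{bmatrix}V^{\mathsf T}:B\in\mathbb{R}^{k\times(n-k)}\bigr\}$. $\exp$ is the matrix exponential. *)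

theory Defs
  imports "HOL-Analysis.Analysis"
begin

section \<open>Smooth maps\<close>

(* Continuous differentiability up to order m on an open set S. *)
primrec Ck_on :: "nat \<Rightarrow> 'a::real_normed_vector set \<Rightarrow> ('a \<Rightarrow> 'b::real_normed_vector) \<Rightarrow> bool" where
  "Ck_on 0 S f \<longleftrightarrow> continuous_on S f"
| "Ck_on (Suc m) S f \<longleftrightarrow>
     (\<forall>x\<in>S. f differentiable at x) \<and> (\<forall>v. Ck_on m S (\<lambda>x. frechet_derivative f (at x) v))"

definition smooth_on :: "'a::real_normed_vector set \<Rightarrow> ('a \<Rightarrow> 'b::real_normed_vector) \<Rightarrow> bool" where
  "smooth_on S f \<longleftrightarrow> (\<forall>m. Ck_on m S f)"

section \<open>Calculus on an embedded submanifold of a Euclidean space\<close>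

(* Throughout, M is an embedded submanifold of a Euclidean space. A map on M is smooth iff it
   locally extends to a smooth map of the ambient space. Functions and vector fields on M are
   total functions whose values outside M are irrelevant. *)
definition smooth_on_mfd :: "'a::euclidean_space set \<Rightarrow> ('a \<Rightarrow> 'b::real_normed_vector) \<Rightarrow> bool" where
  "smooth_on_mfd M f \<longleftrightarrow>
     (\<forall>p\<in>M. \<exists>U F. open U \<and> p \<in> U \<and> smooth_on U F \<and> (\<forall>x\<in>M \<inter> U. F x = f x))"

definition curve_with_velocity :: "'a::euclidean_space set \<Rightarrow> 'a \<Rightarrow> 'a \<Rightarrow> (real \<Rightarrow> 'a) \<Rightarrow> bool" where
  "curve_with_velocity M p v c \<longleftrightarrow>
     (\<exists>e>0. smooth_on {-e<..<e} c \<and> c ` {-e<..<e} \<subseteq> M) \<and>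
     c 0 = p \<and> (c has_vector_derivative v) (at 0)"

definition tangent_space :: "'a::euclidean_space set \<Rightarrow> 'a \<Rightarrow> 'a set" where
  "tangent_space M p = {v. \<exists>c. curve_with_velocity M p v c}"

(* The derivative v(f) = (f o c)'(0) of a smooth function f on M along a tangent vector v at p;
   it does not depend on the curve c in M representing v. *)
definition dir_deriv :: "'a::euclidean_space set \<Rightarrow> ('a \<Rightarrow> real) \<Rightarrow> 'a \<Rightarrow> 'a \<Rightarrow> real" where
  "dir_deriv M f p v =
     (THE d. \<exists>c. curve_with_velocity M p v c \<and> ((f \<circ> c) has_vector_derivative d) (at 0))"

definition vector_fields :: "'a::euclidean_space set \<Rightarrow> ('a \<Rightarrow> 'a) set" where
  "vector_fields M = {X. smooth_on_mfd M X \<and> (\<forall>p\<in>M. X p \<in> tangent_space M p)}"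

section \<open>The Levi-Civita connection\<close>

definition affine_connection ::
    "'a::euclidean_space set \<Rightarrow> (('a \<Rightarrow> 'a) \<Rightarrow> ('a \<Rightarrow> 'a) \<Rightarrow> 'a \<Rightarrow> 'a) \<Rightarrow> bool" where
  "affine_connection M nabla \<longleftrightarrow>
     (\<forall>X\<in>vector_fields M. \<forall>Y\<in>vector_fields M. nabla X Y \<in> vector_fields M) \<and>
     (\<forall>f h. \<forall>X\<in>vector_fields M. \<forall>Y\<in>vector_fields M. \<forall>Z\<in>vector_fields M.
        smooth_on_mfd M f \<longrightarrow> smooth_on_mfd M h \<longrightarrow>
        (\<forall>p\<in>M. nabla (\<lambda>q. f q *\<^sub>R X q + h q *\<^sub>R Y q) Z p = f p *\<^sub>R nabla X Z p + h p *\<^sub>R nabla Y Z p)) \<and>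
     (\<forall>a b. \<forall>X\<in>vector_fields M. \<forall>Y\<in>vector_fields M. \<forall>Z\<in>vector_fields M.
        \<forall>p\<in>M. nabla X (\<lambda>q. a *\<^sub>R Y q + b *\<^sub>R Z q) p = a *\<^sub>R nabla X Y p + b *\<^sub>R nabla X Z p) \<and>
     (\<forall>f. \<forall>X\<in>vector_fields M. \<forall>Y\<in>vector_fields M. smooth_on_mfd M f \<longrightarrow>
        (\<forall>p\<in>M. nabla X (\<lambda>q. f q *\<^sub>R Y q) p = f p *\<^sub>R nabla X Y p + dir_deriv M f p (X p) *\<^sub>R Y p))"

(* The torsion-free condition nabla_X Y - nabla_Y X = [X,Y] is written out as an equality of derivations
   on smooth functions, where [X,Y] f = X (Y f) - Y (X f). *)
definition torsion_free ::
    "'a::euclidean_space set \<Rightarrow> (('a \<Rightarrow> 'a) \<Rightarrow> ('a \<Rightarrow> 'a) \<Rightarrow> 'a \<Rightarrow> 'a) \<Rightarrow> bool" where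
  "torsion_free M nabla \<longleftrightarrow>
     (\<forall>X\<in>vector_fields M. \<forall>Y\<in>vector_fields M. \<forall>f :: 'a \<Rightarrow> real. smooth_on_mfd M f \<longrightarrow>
        (\<forall>p\<in>M. dir_deriv M f p (nabla X Y p - nabla Y X p) =
               dir_deriv M (\<lambda>q. dir_deriv M f q (Y q)) p (X p)
             - dir_deriv M (\<lambda>q. dir_deriv M f q (X q)) p (Y p)))"

definition metric_compatible ::
    "'a::euclidean_space set \<Rightarrow> ('a \<Rightarrow> 'a \<Rightarrow> 'a \<Rightarrow> real) \<Rightarrow>
     (('a \<Rightarrow> 'a) \<Rightarrow> ('a \<Rightarrow> 'a) \<Rightarrow> 'a \<Rightarrow> 'a) \<Rightarrow> bool" where
  "metric_compatible M g nabla \<longleftrightarrow>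
     (\<forall>X\<in>vector_fields M. \<forall>Y\<in>vector_fields M. \<forall>Z\<in>vector_fields M. \<forall>p\<in>M.
        dir_deriv M (\<lambda>q. g q (Y q) (Z q)) p (X p) = g p (nabla X Y p) (Z p) + g p (Y p) (nabla X Z p))"

definition levi_civita_connection ::
    "'a::euclidean_space set \<Rightarrow> ('a \<Rightarrow> 'a \<Rightarrow> 'a \<Rightarrow> real) \<Rightarrow>
     (('a \<Rightarrow> 'a) \<Rightarrow> ('a \<Rightarrow> 'a) \<Rightarrow> 'a \<Rightarrow> 'a) \<Rightarrow> bool" where
  "levi_civita_connection M g nabla \<longleftrightarrow>
     affine_connection M nabla \<and> torsion_free M nabla \<and> metric_compatible M g nabla"

section \<open>Geodesics and parallel transport\<close>

text \<open>In this section \<open>J\<close> is an open interval.\<close>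

definition curve_on :: "'a::euclidean_space set \<Rightarrow> real set \<Rightarrow> (real \<Rightarrow> 'a) \<Rightarrow> bool" where
  "curve_on M J \<gamma> \<longleftrightarrow> smooth_on J \<gamma> \<and> \<gamma> ` J \<subseteq> M"

abbreviation velocity :: "(real \<Rightarrow> 'a::real_normed_vector) \<Rightarrow> real \<Rightarrow> 'a" where
  "velocity \<gamma> t \<equiv> vector_derivative \<gamma> (at t)"

definition fields_along ::
    "'a::euclidean_space set \<Rightarrow> real set \<Rightarrow> (real \<Rightarrow> 'a) \<Rightarrow> (real \<Rightarrow> 'a) set" where
  "fields_along M J \<gamma> = {Z. smooth_on J Z \<and> (\<forall>t\<in>J. Z t \<in> tangent_space M (\<gamma> t))}"

(* D = D/dt is the covariant derivative along \<gamma> induced by the connection: the unique (on J)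
   linear operator that satisfies the product rule and sends a restriction Y o \<gamma> of a vector
   field Y on M to nabla_{\<gamma>'} Y. The latter is tensorial in the lower argument, so its value at t is
   that of nabla_X Y at \<gamma>(t) for any vector field X that extends the vector \<gamma>'(t). *)
definition covariant_derivative_along ::
    "'a::euclidean_space set \<Rightarrow> (('a \<Rightarrow> 'a) \<Rightarrow> ('a \<Rightarrow> 'a) \<Rightarrow> 'a \<Rightarrow> 'a) \<Rightarrow>
     real set \<Rightarrow> (real \<Rightarrow> 'a) \<Rightarrow> ((real \<Rightarrow> 'a) \<Rightarrow> real \<Rightarrow> 'a) \<Rightarrow> bool" where
  "covariant_derivative_along M nabla J \<gamma> D \<longleftrightarrow>
     (\<forall>Z\<in>fields_along M J \<gamma>. D Z \<in> fields_along M J \<gamma>) \<and>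
     (\<forall>a b. \<forall>Z\<in>fields_along M J \<gamma>. \<forall>W\<in>fields_along M J \<gamma>.
        \<forall>t\<in>J. D (\<lambda>s. a *\<^sub>R Z s + b *\<^sub>R W s) t = a *\<^sub>R D Z t + b *\<^sub>R D W t) \<and>
     (\<forall>f. \<forall>Z\<in>fields_along M J \<gamma>. smooth_on J f \<longrightarrow>
        (\<forall>t\<in>J. D (\<lambda>s. f s *\<^sub>R Z s) t = velocity f t *\<^sub>R Z t + f t *\<^sub>R D Z t)) \<and>
     (\<forall>X\<in>vector_fields M. \<forall>Y\<in>vector_fields M. \<forall>Z\<in>fields_along M J \<gamma>.
        (\<forall>s\<in>J. Z s = Y (\<gamma> s)) \<longrightarrow>
        (\<forall>t\<in>J. X (\<gamma> t) = velocity \<gamma> t \<longrightarrow> D Z t = nabla X Y (\<gamma> t)))"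

definition parallel_along ::
    "'a::euclidean_space set \<Rightarrow> (('a \<Rightarrow> 'a) \<Rightarrow> ('a \<Rightarrow> 'a) \<Rightarrow> 'a \<Rightarrow> 'a) \<Rightarrow>
     real set \<Rightarrow> (real \<Rightarrow> 'a) \<Rightarrow> (real \<Rightarrow> 'a) \<Rightarrow> bool" where
  "parallel_along M nabla J \<gamma> Z \<longleftrightarrow>
     Z \<in> fields_along M J \<gamma> \<and>
     (\<exists>D. covariant_derivative_along M nabla J \<gamma> D \<and> (\<forall>t\<in>J. D Z t = 0))"

definition geodesic ::
    "'a::euclidean_space set \<Rightarrow> (('a \<Rightarrow> 'a) \<Rightarrow> ('a \<Rightarrow> 'a) \<Rightarrow> 'a \<Rightarrow> 'a) \<Rightarrow>
     real set \<Rightarrow> (real \<Rightarrow> 'a) \<Rightarrow> bool" where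
  "geodesic M nabla J \<gamma> \<longleftrightarrow> curve_on M J \<gamma> \<and> parallel_along M nabla J \<gamma> (velocity \<gamma>)"

(* Z is the unique parallel field along \<gamma> with value y at time 0. *)
definition is_parallel_transport ::
    "'a::euclidean_space set \<Rightarrow> (('a \<Rightarrow> 'a) \<Rightarrow> ('a \<Rightarrow> 'a) \<Rightarrow> 'a \<Rightarrow> 'a) \<Rightarrow>
     real set \<Rightarrow> (real \<Rightarrow> 'a) \<Rightarrow> 'a \<Rightarrow> (real \<Rightarrow> 'a) \<Rightarrow> bool" where
  "is_parallel_transport M nabla J \<gamma> y Z \<longleftrightarrow>
     parallel_along M nabla J \<gamma> Z \<and> Z 0 = y \<and>
     (\<forall>W. parallel_along M nabla J \<gamma> W \<and> W 0 = y \<longrightarrow> (\<forall>t\<in>J. W t = Z t))"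

section \<open>Matrices and the Grassmannian\<close>

(* The componentwise product makes the type class function exp unsuitable for square matrices. *)
primrec mat_power :: "real ^ 'n ^ 'n \<Rightarrow> nat \<Rightarrow> real ^ 'n ^ 'n" where
  "mat_power A 0 = mat 1"
| "mat_power A (Suc m) = A ** mat_power A m"

definition mat_exp :: "real ^ 'n ^ 'n \<Rightarrow> real ^ 'n ^ 'n" where
  "mat_exp A = (\<Sum>m. (1 / fact m) *\<^sub>R mat_power A m)"

(* The zero-based position of an index in the linear order of the index type; it identifies
   the index type 'n with {0..<n} for n = CARD('n). *)
definition index_pos :: "'n::{finite,linorder} \<Rightarrow> nat" where
  "index_pos i = card {j. j < i}"

(* The matrix [A B; C D] with blocks of sizes k x k, k x (n-k), (n-k) x k, (n-k) x (n-k),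
   for k \<le> n. A block is given by its zero-based entries; entries outside its size are unused.
   The case k = n, with empty blocks, is allowed. *)
definition block_matrix ::
    "nat \<Rightarrow> (nat \<Rightarrow> nat \<Rightarrow> real) \<Rightarrow> (nat \<Rightarrow> nat \<Rightarrow> real) \<Rightarrow>
     (nat \<Rightarrow> nat \<Rightarrow> real) \<Rightarrow> (nat \<Rightarrow> nat \<Rightarrow> real) \<Rightarrow> real ^ 'n::{finite,linorder} ^ 'n::{finite,linorder}" where
  "block_matrix k A B C D = (\<chi> i j.
     if index_pos i < k
     then (if index_pos j < k then A (index_pos i) (index_pos j) else B (index_pos i) (index_pos j - k))
     else (if index_pos j < k then C (index_pos i - k) (index_pos j) else D (index_pos i - k) (index_pos j - k)))"

definition signature_matrix :: "nat \<Rightarrow> real ^ 'n::{finite,linorder} ^ 'n::{finite,linorder}" where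
  "signature_matrix k = block_matrix k
     (\<lambda>i j. if i = j then 1 else 0) (\<lambda>i j. 0) (\<lambda>i j. 0) (\<lambda>i j. if i = j then -1 else 0)"

(* [0 B; C 0] *)
definition off_diag :: "nat \<Rightarrow> (nat \<Rightarrow> nat \<Rightarrow> real) \<Rightarrow> (nat \<Rightarrow> nat \<Rightarrow> real) \<Rightarrow>
    real ^ 'n::{finite,linorder} ^ 'n::{finite,linorder}" where
  "off_diag k B C = block_matrix k (\<lambda>i j. 0) B C (\<lambda>i j. 0)"

definition Gr :: "nat \<Rightarrow> (real ^ 'n ^ 'n) set" where
  "Gr k = {Q. orthogonal_matrix Q \<and> transpose Q = Q \<and> trace Q = 2 * real k - real CARD('n)}"

definition Gr_metric :: "real ^ 'n ^ 'n \<Rightarrow> real ^ 'n ^ 'n \<Rightarrow> real ^ 'n ^ 'n \<Rightarrow> real" where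
  "Gr_metric Q X Y = trace (X ** Y)"

end

(* Write P(q) for the orthogonal projection onto the tangent space at q. The vector fields
   q |-> P(q) E with E constant have polynomial extensions to all matrices, and torsion-freeness and
   metric compatibility force nabla to be the projected flat derivative on them: the difference is
   a trilinear form that is symmetric in two arguments and skew in two. Every field W along gamma
   is a combination of such fields with coefficients the coordinates of W, so DW/dt = P(W').

   Hence the geodesic equation says that gamma' gamma is constant, say equal to 2A with
   A = XQ/2, and gamma is Q conjugated by exp(tA). Conjugating Y by exp(tA) yields a
   tangent field Z along gamma whose derivative AZ - ZA commutes with gamma and so is normal.
   The difference of two parallel fields has constant norm, which gives uniqueness. *)
theory Submission
  imports Defs
begin

section \<open>Smooth maps and directional derivatives\<close>

lemma Ck_on_cong:
  assumes "open S" "\<And>x. x \<in> S \<Longrightarrow> f x = g x" "Ck_on m S f"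
  shows "Ck_on m S g"
  using assms(2,3)
proof (induction m arbitrary: f g)
  case 0
  then show ?case by (simp cong: continuous_on_cong)
next
  case (Suc m)
  have d: "(g has_derivative frechet_derivative f (at x)) (at x)" if "x \<in> S" for x
    using Suc.prems that has_derivative_transform_within_open[OF _ assms(1)]
    by (metis Ck_on.simps(2) frechet_derivative_works)
  have "frechet_derivative g (at x) = frechet_derivative f (at x)" if "x \<in> S" for x
    using d[OF that] frechet_derivative_at by metis
  then have "Ck_on m S (\<lambda>x. frechet_derivative g (at x) v)" for v
    using Suc.IH[of "\<lambda>x. frechet_derivative f (at x) v"] Suc.prems(2) by simp
  then show ?case using d by (auto simp: differentiable_def)
qed

lemma Ck_on_Suc_D: "Ck_on (Suc m) S f \<Longrightarrow> Ck_on m S f"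
proof (induction m arbitrary: f)
  case 0
  then show ?case
    by (auto intro!: continuous_at_imp_continuous_on differentiable_imp_continuous_within)
next
  case (Suc m)
  then show ?case by (metis Ck_on.simps(2))
qed

text \<open>Lets an explicit derivative \<open>f'\<close> stand in for the chosen
  \<open>frechet_derivative\<close> of the definition; the closure properties below are proved
  through it.\<close>

lemma Ck_on_SucI:
  assumes "open S" "\<And>x. x \<in> S \<Longrightarrow> (f has_derivative f' x) (at x)"
    and "\<And>v. Ck_on m S (\<lambda>x. f' x v)"
  shows "Ck_on (Suc m) S f"
proof -
  have "frechet_derivative f (at x) = f' x" if "x \<in> S" for x
    using assms(2)[OF that] frechet_derivative_at by metis
  then show ?thesis
    using assms Ck_on_cong[OF assms(1) _ assms(3)] by (auto simp: differentiable_def)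
qed

lemma Ck_on_SucD:
  assumes "Ck_on (Suc m) S f"
  shows "x \<in> S \<Longrightarrow> (f has_derivative frechet_derivative f (at x)) (at x)"
    and "Ck_on m S (\<lambda>x. frechet_derivative f (at x) v)"
  using assms by (auto simp: frechet_derivative_works[symmetric])

lemma Ck_on_const: "Ck_on m S (\<lambda>x. c)"
  by (induction m arbitrary: c) auto

lemma Ck_on_bounded_linear:
  assumes "bounded_linear L" "open S" "Ck_on m S f"
  shows "Ck_on m S (\<lambda>x. L (f x))"
  using assms(3)
proof (induction m arbitrary: f)
  case 0
  then show ?case using assms(1) by (auto intro: bounded_linear.continuous_on)
next
  case (Suc m)
  show ?case
    by (rule Ck_on_SucI[OF assms(2) bounded_linear.has_derivative[OF assms(1)]])
      (use Suc.IH Ck_on_SucD[OF Suc.prems] in auto)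
qed

lemma Ck_on_id: "open S \<Longrightarrow> Ck_on m S (\<lambda>x. x)"
  by (cases m) (auto intro!: Ck_on_SucI[where f' = "\<lambda>_ v. v"] Ck_on_const simp del: Ck_on.simps(2))

lemma Ck_on_add:
  assumes "open S" "Ck_on m S f" "Ck_on m S g"
  shows "Ck_on m S (\<lambda>x. f x + g x)"
  using assms(2,3)
proof (induction m arbitrary: f g)
  case 0
  then show ?case by (auto intro: continuous_intros)
next
  case (Suc m)
  show ?case
    by (rule Ck_on_SucI[OF assms(1) has_derivative_add])
      (auto intro!: Suc.IH Ck_on_SucD[OF Suc.prems(1)] Ck_on_SucD[OF Suc.prems(2)])
qed

text \<open>The Leibniz rule expresses the derivative as a sum of two products of the same kind. In
  each, the undifferentiated factor is lowered by one order with \<open>Ck_on_Suc_D\<close>, so the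
  induction hypothesis applies.\<close>

lemma Ck_on_bounded_bilinear:
  assumes "bounded_bilinear p" "open S" "Ck_on m S f" "Ck_on m S g"
  shows "Ck_on m S (\<lambda>x. p (f x) (g x))"
  using assms(3,4)
proof (induction m arbitrary: f g)
  case 0
  then show ?case using assms(1) by (auto intro: bounded_bilinear.continuous_on)
next
  case (Suc m)
  show ?case
    by (rule Ck_on_SucI[OF assms(2) bounded_bilinear.FDERIV[OF assms(1)]])
      (auto intro!: Ck_on_add assms(2) Suc.IH Suc.prems[THEN Ck_on_Suc_D]
        Ck_on_SucD[OF Suc.prems(1)] Ck_on_SucD[OF Suc.prems(2)])
qed

lemma smooth_on_const: "smooth_on S (\<lambda>x. c)"
  by (simp add: smooth_on_def Ck_on_const)

lemma smooth_on_id: "open S \<Longrightarrow> smooth_on S (\<lambda>x. x)"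
  by (simp add: smooth_on_def Ck_on_id)

lemma smooth_on_bounded_linear:
  "bounded_linear L \<Longrightarrow> open S \<Longrightarrow> smooth_on S f \<Longrightarrow> smooth_on S (\<lambda>x. L (f x))"
  by (simp add: smooth_on_def Ck_on_bounded_linear)

lemma smooth_on_add:
  "open S \<Longrightarrow> smooth_on S f \<Longrightarrow> smooth_on S g \<Longrightarrow> smooth_on S (\<lambda>x. f x + g x)"
  by (simp add: smooth_on_def Ck_on_add)

lemma smooth_on_bounded_bilinear:
  "bounded_bilinear p \<Longrightarrow> open S \<Longrightarrow> smooth_on S f \<Longrightarrow> smooth_on S g \<Longrightarrow>
    smooth_on S (\<lambda>x. p (f x) (g x))"
  by (simp add: smooth_on_def Ck_on_bounded_bilinear)

lemma smooth_on_diff: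
  "open S \<Longrightarrow> smooth_on S f \<Longrightarrow> smooth_on S g \<Longrightarrow> smooth_on S (\<lambda>x. f x - g x)"
  using smooth_on_add[OF _ _ smooth_on_bounded_linear[OF bounded_linear_minus[OF bounded_linear_ident]]]
  by fastforce

lemma smooth_on_has_vector_derivative:
  assumes "smooth_on S f" "t \<in> S"
  shows "(f has_vector_derivative velocity f t) (at t)"
proof -
  have "Ck_on (Suc 0) S f" using assms(1) unfolding smooth_on_def by blast
  then show ?thesis using assms(2) by (simp add: vector_derivative_works)
qed

text \<open>Bootstrapping: if \<open>f\<close> is of class \<open>m\<close>, then so is its
  derivative, the image of \<open>f\<close> under \<open>L\<close>, and hence \<open>f\<close> is of
  class \<open>Suc m\<close>.\<close>

lemma smooth_on_linear_ode:
  fixes f :: "real \<Rightarrow> 'a::real_normed_vector"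
  assumes "open S" "bounded_linear L"
    and "\<And>t. t \<in> S \<Longrightarrow> (f has_vector_derivative L (f t)) (at t)"
  shows "smooth_on S f"
proof -
  have "Ck_on m S f" for m
  proof (induction m)
    case 0
    show ?case
      using assms(3) by (auto intro!: continuous_at_imp_continuous_on has_vector_derivative_continuous)
  next
    case (Suc m)
    show ?case
      by (rule Ck_on_SucI[OF assms(1) assms(3)[unfolded has_vector_derivative_def]])
        (auto intro!: Ck_on_bounded_linear[OF bounded_linear_const_scaleR] assms
          Ck_on_bounded_linear[OF assms(2)] Suc)
  qed
  then show ?thesis by (simp add: smooth_on_def)
qed

text \<open>A curve representing \<open>v\<close> stays in \<open>M\<close> near 0, so
  \<open>h\<close> may be replaced by its ambient extension \<open>H\<close> along it. The chain
  rule then gives the same value for every such curve, which settles the definite description in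
  \<open>dir_deriv\<close>; tangency of \<open>v\<close> supplies a curve.\<close>

lemma dir_deriv_eqI:
  assumes "v \<in> tangent_space M p" "\<And>q. q \<in> M \<Longrightarrow> h q = H q" "(H has_derivative H') (at p)"
  shows "dir_deriv M h p v = H' v"
proof -
  have d: "((h \<circ> c) has_vector_derivative H' v) (at 0)" if "curve_with_velocity M p v c" for c
  proof -
    from that obtain e where e: "e > 0" "c ` {-e<..<e} \<subseteq> M" and c: "c 0 = p"
      "(c has_vector_derivative v) (at 0)"
      unfolding curve_with_velocity_def by blast
    have "((H \<circ> c) has_vector_derivative H' v) (at 0)"
      by (rule vector_derivative_diff_chain_within[OF c(2)])
        (use assms(3) c(1) in \<open>auto intro: has_derivative_at_withinI\<close>)
    then show ?thesis
      by (rule has_vector_derivative_transform_within_open[of _ _ _ "{-e<..<e}"])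
        (use e assms(2) in \<open>auto simp: image_subset_iff\<close>)
  qed
  obtain c where "curve_with_velocity M p v c"
    using assms(1) unfolding tangent_space_def by blast
  with d show ?thesis
    unfolding dir_deriv_def by (intro the_equality) (auto intro: vector_derivative_unique_at)
qed

lemma smooth_on_mfdI: "smooth_on UNIV F \<Longrightarrow> smooth_on_mfd M F"
  unfolding smooth_on_mfd_def by blast

section \<open>Matrix algebra: bilinearity of the product, transposes, trace and inner
  product\<close>

lemma bounded_bilinear_matrix_mult:
  "bounded_bilinear ((**) :: real^'n^'m \<Rightarrow> real^'p^'n \<Rightarrow> real^'p^'m)"
  unfolding bilinear_conv_bounded_bilinear[symmetric] bilinear_def
  by (auto intro!: linearI simp: matrix_add_ldistrib matrix_matrix_mult_def vec_eq_iff
      sum.distrib algebra_simps sum_distrib_left)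

lemmas matrix_add_rdistrib = bounded_bilinear.add_left[OF bounded_bilinear_matrix_mult]
lemmas matrix_diff_ldistrib = bounded_bilinear.diff_right[OF bounded_bilinear_matrix_mult]
lemmas matrix_diff_rdistrib = bounded_bilinear.diff_left[OF bounded_bilinear_matrix_mult]
lemmas matrix_minus_left = bounded_bilinear.minus_left[OF bounded_bilinear_matrix_mult]
lemmas matrix_minus_right = bounded_bilinear.minus_right[OF bounded_bilinear_matrix_mult]
lemmas matrix_scaleR_left = bounded_bilinear.scaleR_left[OF bounded_bilinear_matrix_mult]
lemmas matrix_scaleR_right = bounded_bilinear.scaleR_right[OF bounded_bilinear_matrix_mult]
lemmas matrix_zero_left = bounded_bilinear.zero_left[OF bounded_bilinear_matrix_mult]
lemmas matrix_zero_right = bounded_bilinear.zero_right[OF bounded_bilinear_matrix_mult]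

lemmas matrix_mult_simps =
  matrix_add_ldistrib matrix_add_rdistrib matrix_diff_ldistrib matrix_diff_rdistrib
  matrix_minus_left matrix_minus_right matrix_scaleR_left matrix_scaleR_right
  matrix_zero_left matrix_zero_right

lemma bounded_linear_transpose: "bounded_linear (transpose :: real^'n^'m \<Rightarrow> real^'m^'n)"
  by (intro linear_conv_bounded_linear[THEN iffD1] linearI)
    (auto simp: transpose_def vec_eq_iff)

lemma transpose_add: "transpose (A + B) = transpose A + transpose (B :: real^'n^'m)"
  and transpose_diff: "transpose (A - B) = transpose A - transpose (B :: real^'n^'m)"
  and transpose_minus: "transpose (- A) = - transpose (A :: real^'n^'m)"
  by (auto simp: transpose_def vec_eq_iff)

lemmas transpose_simps =
  transpose_add transpose_diff transpose_minus transpose_scalar matrix_transpose_mul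

lemmas has_vector_derivative_matrix_mult =
  bounded_bilinear.has_vector_derivative[OF bounded_bilinear_matrix_mult]

text \<open>On symmetric matrices the transpose disappears, so \<open>Gr_metric\<close> is the
  ambient Euclidean inner product restricted to tangent vectors.\<close>

lemma trace_mult_eq_inner: "trace (A ** B) = A \<bullet> transpose (B :: real^'n^'n)"
  by (simp add: trace_def matrix_matrix_mult_def inner_vec_def transpose_def)

lemma inner_transpose: "transpose A \<bullet> transpose B = A \<bullet> (B :: real^'n^'m)"
  unfolding inner_vec_def transpose_def by simp (rule sum.swap)

lemma inner_matrix_mult_left:
  fixes M A B :: "real^'n^'n"
  shows "(M ** A) \<bullet> B = A \<bullet> (transpose M ** B)"
proof -
  have "(M ** A) \<bullet> B = trace (M ** A ** transpose B)"
    by (simp add: trace_mult_eq_inner)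
  also have "\<dots> = trace (A ** (transpose B ** M))"
    by (metis matrix_mul_assoc trace_mul_sym)
  also have "\<dots> = A \<bullet> (transpose M ** B)"
    by (simp add: trace_mult_eq_inner matrix_transpose_mul)
  finally show ?thesis .
qed

lemma inner_matrix_mult_right:
  fixes M A B :: "real^'n^'n"
  shows "(A ** M) \<bullet> B = A \<bullet> (B ** transpose M)"
  using inner_matrix_mult_left[of "transpose M" "transpose A" "transpose B"]
  by (metis inner_transpose matrix_transpose_mul transpose_transpose)

section \<open>The matrix exponential\<close>

lemma mat_power_commute:
  assumes "C ** A = A ** C" shows "C ** mat_power A m = mat_power A m ** C"
proof (induction m)
  case (Suc m)
  have "C ** (A ** mat_power A m) = A ** (C ** mat_power A m)"
    by (simp add: matrix_mul_assoc assms)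
  then show ?case by (simp add: Suc matrix_mul_assoc)
qed simp

lemma mat_power_scaleR: "mat_power (t *\<^sub>R A) m = t ^ m *\<^sub>R mat_power A m"
  by (induction m) (auto simp: matrix_mult_simps)

lemma transpose_mat_power: "transpose (mat_power A m) = mat_power (transpose A) m"
  by (induction m) (auto simp: matrix_transpose_mul mat_power_commute)

lemma mat_power_conj:
  assumes "W ** V = mat 1" "V ** W = mat 1"
  shows "mat_power (V ** A ** W) m = V ** mat_power A m ** W"
proof (induction m)
  case 0
  then show ?case using assms by simp
next
  case (Suc m)
  have "V ** A ** W ** (V ** mat_power A m ** W) = V ** A ** (W ** V) ** mat_power A m ** W"
    by (simp add: matrix_mul_assoc)
  then show ?case by (simp add: Suc assms matrix_mul_assoc)
qed

text \<open>Comparison with the real exponential series of \<open>norm A * K\<close>, where the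
  bound \<open>K\<close> of the bilinear product plays the part of submultiplicativity.\<close>

lemma summable_mat_exp:
  fixes A :: "real^'a^'a"
  shows "summable (\<lambda>m. (1 / fact m) *\<^sub>R mat_power A m)"
proof -
  obtain K where K: "K > 0" "\<And>A B. norm ((A :: real^'a^'a) ** (B :: real^'a^'a)) \<le> norm A * norm B * K"
    using bounded_bilinear.pos_bounded[OF bounded_bilinear_matrix_mult] by blast
  have b: "norm (mat_power A m) \<le> (norm A * K) ^ m * norm (mat 1 :: real^'a^'a)" for m
  proof (induction m)
    case (Suc m)
    have "norm (mat_power A (Suc m)) \<le> (norm A * K) * norm (mat_power A m)"
      using K(2)[of A "mat_power A m"] by (simp add: mult_ac)
    also have "\<dots> \<le> (norm A * K) * ((norm A * K) ^ m * norm (mat 1 :: real^'a^'a))"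
      using Suc K(1) by (intro mult_left_mono) auto
    finally show ?case by (simp add: mult_ac)
  qed simp
  have "summable (\<lambda>m. norm (mat 1 :: real^'a^'a) * ((norm A * K) ^ m /\<^sub>R fact m))"
    by (intro summable_mult summable_exp_generic)
  then show ?thesis
    by (rule summable_comparison_test_ev[rotated])
      (use b in \<open>auto intro!: always_eventually simp: field_simps\<close>)
qed

text \<open>Continuity moves \<open>L\<close> inside the series. Taking \<open>L\<close> to be a
  multiplication, the transpose, a conjugation or a matrix entry reduces facts on
  \<open>mat_exp\<close> to facts on powers.\<close>

lemma bounded_linear_mat_exp:
  assumes "bounded_linear L"
  shows "L (mat_exp A) = (\<Sum>m. (1 / fact m) *\<^sub>R L (mat_power A m))"
    and "summable (\<lambda>m. (1 / fact m) *\<^sub>R L (mat_power A m))"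
proof -
  interpret bounded_linear L by fact
  show "L (mat_exp A) = (\<Sum>m. (1 / fact m) *\<^sub>R L (mat_power A m))"
    unfolding mat_exp_def by (simp add: suminf[OF summable_mat_exp] scaleR)
  show "summable (\<lambda>m. (1 / fact m) *\<^sub>R L (mat_power A m))"
    using summable[OF summable_mat_exp[of A]] by (simp add: scaleR)
qed

lemmas bounded_linear_matrix_mult_left =
  bounded_bilinear.bounded_linear_left[OF bounded_bilinear_matrix_mult]
lemmas bounded_linear_matrix_mult_right =
  bounded_bilinear.bounded_linear_right[OF bounded_bilinear_matrix_mult]

lemma mat_exp_commute:
  assumes "C ** A = A ** C" shows "C ** mat_exp A = mat_exp A ** C"
  by (simp add: bounded_linear_mat_exp(1)[OF bounded_linear_matrix_mult_left]
      bounded_linear_mat_exp(1)[OF bounded_linear_matrix_mult_right] mat_power_commute[OF assms])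

lemma transpose_mat_exp: "transpose (mat_exp A) = mat_exp (transpose A)"
  by (subst bounded_linear_mat_exp(1)[OF bounded_linear_transpose])
    (simp add: transpose_mat_power mat_exp_def)

lemma mat_exp_conj:
  assumes "W ** V = mat 1" "V ** W = mat 1"
  shows "mat_exp (V ** A ** W) = V ** mat_exp A ** W"
proof -
  have "bounded_linear (\<lambda>M. V ** M ** W)"
    by (intro bounded_linear_compose[OF bounded_linear_matrix_mult_left]
        bounded_linear_matrix_mult_right)
  from bounded_linear_mat_exp(1)[OF this, of A] show ?thesis
    by (simp add: mat_exp_def mat_power_conj[OF assms])
qed

lemma mat_exp_0 [simp]: "mat_exp 0 = mat 1"
proof -
  have "(1 / fact m) *\<^sub>R mat_power (0 :: real^'a^'a) m = (if m = 0 then mat 1 else 0)" for m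
    by (cases m) (auto simp: matrix_mult_simps)
  then show ?thesis
    using sums_single[of 0 "\<lambda>_. mat 1 :: real^'a^'a"] by (simp add: mat_exp_def sums_iff)
qed

lemma has_vector_derivative_mat_exp:
  fixes A :: "real^'n^'n"
  shows "((\<lambda>t. mat_exp (t *\<^sub>R A)) has_vector_derivative A ** mat_exp (t *\<^sub>R A)) (at t)"
proof -
  \<comment> \<open>The extra factor \<open>M\<close> covers two power series at once:
    \<open>mat 1\<close> gives the coefficients of the exponential and \<open>A\<close> those of its
    claimed derivative. Termwise differentiation takes the first family to the second.\<close>
  define c where "c M m = (1 / fact m) *\<^sub>R (M ** mat_power A m)" for M :: "real^'n^'n" and m
  have lin: "bounded_linear (\<lambda>B. (M ** B) $ i $ j)" for M :: "real^'n^'n" and i j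
    by (intro bounded_linear_compose[OF bounded_linear_vec_nth]
        bounded_linear_matrix_mult_right)
  have c: "(M ** mat_exp (s *\<^sub>R A)) $ i $ j = (\<Sum>m. c M m $ i $ j * s ^ m)"
    "summable (\<lambda>m. c M m $ i $ j * s ^ m)" for M i j s
    using bounded_linear_mat_exp[OF lin[of M i j], of "s *\<^sub>R A"]
    by (simp_all add: mat_power_scaleR c_def matrix_mult_simps mult_ac)
  have diffs: "diffs (\<lambda>m. c (mat 1) m $ i $ j) = (\<lambda>m. c A m $ i $ j)" for i j
    by (rule ext) (simp add: diffs_def c_def del: of_nat_Suc)
  have entry: "((\<lambda>t. mat_exp (t *\<^sub>R A) $ i $ j) has_vector_derivative (A ** mat_exp (t *\<^sub>R A)) $ i $ j) (at t)"
    for i j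
    using termdiffs_strong_converges_everywhere[OF c(2)[of "mat 1" i j], of t]
    by (simp add: diffs c(1)[of "mat 1", simplified] c(1)[of A]
        has_real_derivative_iff_has_vector_derivative)
  show ?thesis
    unfolding has_vector_derivative_def
  proof (rule has_derivative_componentwise_within[THEN iffD2], rule ballI)
    fix b :: "real^'n^'n" assume "b \<in> Basis"
    then obtain i j where b: "b = axis i (axis j 1)" by (auto simp: Basis_vec_def)
    show "((\<lambda>t. mat_exp (t *\<^sub>R A) \<bullet> b) has_derivative (\<lambda>x. x *\<^sub>R (A ** mat_exp (t *\<^sub>R A)) \<bullet> b)) (at t)"
      using entry[of i j] unfolding b has_vector_derivative_def by (simp add: inner_axis)
  qed
qed

lemma has_vector_derivative_mat_exp_minus:
  "((\<lambda>t. mat_exp (t *\<^sub>R (- A))) has_vector_derivative - (mat_exp (t *\<^sub>R (- A)) ** A)) (at t)"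
proof -
  have "A ** mat_exp (t *\<^sub>R (- A)) = mat_exp (t *\<^sub>R (- A)) ** A"
    by (rule mat_exp_commute) (simp add: matrix_mult_simps)
  then show ?thesis
    using has_vector_derivative_mat_exp[of "- A" t] by (simp add: matrix_mult_simps)
qed

text \<open>The product has derivative zero, because \<open>A\<close> commutes with its
  exponentials, and it equals \<open>mat 1\<close> at time 0.\<close>

lemma mat_exp_mult_minus: "mat_exp (t *\<^sub>R A) ** mat_exp (t *\<^sub>R (- A)) = mat 1"
proof -
  have "((\<lambda>t. mat_exp (t *\<^sub>R A) ** mat_exp (t *\<^sub>R (- A))) has_vector_derivative 0) (at t)"
    for t
    by (rule has_vector_derivative_eq_rhs[OF has_vector_derivative_matrix_mult[OF
            has_vector_derivative_mat_exp has_vector_derivative_mat_exp_minus]])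
      (simp add: matrix_mult_simps matrix_mul_assoc[symmetric] mat_exp_commute)
  then obtain c where c: "\<And>t. t \<in> UNIV \<Longrightarrow> mat_exp (t *\<^sub>R A) ** mat_exp (t *\<^sub>R (- A)) = c"
    using has_vector_derivative_zero_constant[OF convex_UNIV,
        of "\<lambda>t. mat_exp (t *\<^sub>R A) ** mat_exp (t *\<^sub>R (- A))"] by auto
  from c[of 0] c[of t] show ?thesis by simp
qed

lemma mat_exp_minus_mult: "mat_exp (t *\<^sub>R (- A)) ** mat_exp (t *\<^sub>R A) = mat 1"
  using mat_exp_mult_minus[of t "- A"] by simp

section \<open>Conjugation by a one-parameter group\<close>

text \<open>The flow of the linear field \<open>Y \<mapsto> A ** Y - Y ** A\<close>. For skew
  \<open>A\<close> it is conjugation by rotations; geodesics and parallel fields both turn out to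
  have this form.\<close>

definition conj_flow :: "real^'n^'n \<Rightarrow> real^'n^'n \<Rightarrow> real \<Rightarrow> real^'n^'n" where
  "conj_flow A Y t = mat_exp (t *\<^sub>R A) ** Y ** mat_exp (t *\<^sub>R (- A))"

lemma conj_flow_0 [simp]: "conj_flow A Y 0 = Y"
  by (simp add: conj_flow_def)

text \<open>The two inner exponentials cancel. Algebraic relations at time 0, such as being an
  involution or anticommuting, are thereby carried along the flow.\<close>

lemma conj_flow_mult: "conj_flow A X t ** conj_flow A Y t = conj_flow A (X ** Y) t"
proof -
  have "conj_flow A X t ** conj_flow A Y t =
      mat_exp (t *\<^sub>R A) ** X ** (mat_exp (t *\<^sub>R (- A)) ** mat_exp (t *\<^sub>R A)) ** Y ** mat_exp (t *\<^sub>R (- A))"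
    by (simp only: conj_flow_def matrix_mul_assoc)
  also have "\<dots> = conj_flow A (X ** Y) t"
    by (simp only: mat_exp_minus_mult matrix_mul_rid conj_flow_def matrix_mul_assoc)
  finally show ?thesis .
qed

lemma conj_flow_mat_1: "conj_flow A (mat 1) t = mat 1"
  by (simp only: conj_flow_def matrix_mul_rid mat_exp_mult_minus)

lemma conj_flow_minus: "conj_flow A (- Y) t = - conj_flow A Y t"
  by (simp add: conj_flow_def matrix_minus_left matrix_minus_right)

lemma conj_flow_self: "conj_flow A A t = A"
proof -
  have "mat_exp (t *\<^sub>R A) ** A = A ** mat_exp (t *\<^sub>R A)"
    by (rule mat_exp_commute[symmetric]) (simp add: matrix_mult_simps)
  then show ?thesis
    by (metis conj_flow_def mat_exp_mult_minus matrix_mul_assoc matrix_mul_rid)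
qed

lemma trace_conj_flow: "trace (conj_flow A Y t) = trace Y"
proof -
  have "trace (conj_flow A Y t) = trace (mat_exp (t *\<^sub>R (- A)) ** mat_exp (t *\<^sub>R A) ** Y)"
    unfolding conj_flow_def by (subst trace_mul_sym) (simp only: matrix_mul_assoc)
  then show ?thesis by (simp only: mat_exp_minus_mult matrix_mul_lid)
qed

lemma transpose_conj_flow:
  "transpose A = - A \<Longrightarrow> transpose (conj_flow A Y t) = conj_flow A (transpose Y) t"
  by (simp add: conj_flow_def transpose_mat_exp transpose_simps matrix_mul_assoc)

lemma has_vector_derivative_conj_flow:
  "(conj_flow A Y has_vector_derivative A ** conj_flow A Y t - conj_flow A Y t ** A) (at t)"
  unfolding conj_flow_def[abs_def]
  by (rule has_vector_derivative_eq_rhs[OF has_vector_derivative_matrix_mult[OF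
          has_vector_derivative_matrix_mult[OF has_vector_derivative_mat_exp
            has_vector_derivative_const] has_vector_derivative_mat_exp_minus]])
    (simp add: matrix_mult_simps matrix_mul_assoc)

lemma smooth_on_conj_flow: "open S \<Longrightarrow> smooth_on S (conj_flow A Y)"
  by (rule smooth_on_linear_ode[OF _ _ has_vector_derivative_conj_flow])
    (auto intro: bounded_linear_sub bounded_linear_matrix_mult_left bounded_linear_matrix_mult_right)

section \<open>The Grassmannian\<close>

lemma Gr_iff:
  "q \<in> Gr k \<longleftrightarrow> q ** q = mat 1 \<and> transpose q = q \<and> trace q = 2 * real k - real CARD('n)"
  for q :: "real^'n^'n"
  unfolding Gr_def orthogonal_matrix by auto

lemma conj_flow_in_Gr: "transpose A = - A \<Longrightarrow> q \<in> Gr k \<Longrightarrow> conj_flow A q t \<in> Gr k"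
  by (simp add: Gr_iff conj_flow_mult conj_flow_mat_1 transpose_conj_flow trace_conj_flow)

lemma matrix_mult_cancel_left: "A ** B = mat 1 \<Longrightarrow> A ** (B ** C) = C"
  by (simp add: matrix_mul_assoc)

text \<open>Differentiating \<open>c t ** c t = mat 1\<close> and the symmetry of \<open>c t\<close>
  gives one inclusion. Conversely, half of \<open>v ** q\<close> is a skew matrix whose commutator
  with \<open>q\<close> is \<open>v\<close>, so its conjugation flow through \<open>q\<close> is a
  curve in the Grassmannian with velocity \<open>v\<close>.\<close>

lemma tangent_space_Gr:
  assumes q: "q \<in> Gr k"
  shows "tangent_space (Gr k) q = {v. transpose v = v \<and> q ** v = - (v ** q)}"
proof (intro equalityI subsetI)
  fix v assume "v \<in> tangent_space (Gr k) q"
  then obtain c e where e: "e > 0" "c ` {-e<..<e} \<subseteq> Gr k" and c: "c 0 = q"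
    "(c has_vector_derivative v) (at 0)"
    unfolding tangent_space_def curve_with_velocity_def by blast
  have inv: "c t ** c t = mat 1" "transpose (c t) = c t" if "t \<in> {-e<..<e}" for t
  proof -
    have "c t \<in> Gr k" using that e(2) by blast
    then show "c t ** c t = mat 1" "transpose (c t) = c t" by (auto simp: Gr_iff)
  qed
  have "((\<lambda>t. c t ** c t) has_vector_derivative q ** v + v ** q) (at 0)"
    using has_vector_derivative_matrix_mult[OF c(2) c(2)] c(1) by simp
  moreover have "((\<lambda>t. c t ** c t) has_vector_derivative 0) (at 0)"
    by (rule has_vector_derivative_transform_within_open[OF
          has_vector_derivative_const[of "mat 1"], of "{-e<..<e}"]) (use e inv in auto)
  ultimately have "q ** v + v ** q = 0" by (rule vector_derivative_unique_at)
  moreover have "transpose v = v"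
  proof (rule vector_derivative_unique_at[OF _ c(2)])
    show "(c has_vector_derivative transpose v) (at 0)"
      by (rule has_vector_derivative_transform_within_open[OF
            bounded_linear.has_vector_derivative[OF bounded_linear_transpose c(2)], of "{-e<..<e}"])
        (use e inv in auto)
  qed
  ultimately show "v \<in> {v. transpose v = v \<and> q ** v = - (v ** q)}"
    by (simp add: eq_neg_iff_add_eq_0)
next
  fix v assume "v \<in> {v. transpose v = v \<and> q ** v = - (v ** q)}"
  then have v: "transpose v = v" "q ** v = - (v ** q)" by auto
  note q' = q[unfolded Gr_iff]
  define A where "A = (1/2) *\<^sub>R (v ** q)"
  have "transpose A = - A"
    using q' v by (simp add: A_def transpose_simps)
  moreover have "A ** q - q ** A = v"
    using q' v
    by (simp add: A_def matrix_mult_simps matrix_mul_assoc[symmetric] matrix_mult_cancel_left)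
      (simp add: matrix_mul_assoc v matrix_mult_simps, simp add: matrix_mul_assoc[symmetric] q'
        flip: scaleR_add_left)
  ultimately have "curve_with_velocity (Gr k) q v (conj_flow A q)"
    unfolding curve_with_velocity_def
    using has_vector_derivative_conj_flow[of A q 0] q
    by (auto intro!: exI[of _ 1] smooth_on_conj_flow conj_flow_in_Gr)
  then show "v \<in> tangent_space (Gr k) q"
    unfolding tangent_space_def by blast
qed

text \<open>With S the symmetric part of \<open>A\<close>, this is the average of S and -qSq: first
  the projection onto symmetric matrices, then onto those that anticommute with \<open>q\<close>.
  The formula makes sense for every matrix \<open>q\<close>, which provides ambient
  extensions.\<close>

definition Gr_proj :: "real^'n^'n \<Rightarrow> real^'n^'n \<Rightarrow> real^'n^'n" where
  "Gr_proj q A = (1/4) *\<^sub>R (A + transpose A - q ** (A + transpose A) ** q)"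

definition Gr_proj_deriv :: "real^'n^'n \<Rightarrow> real^'n^'n \<Rightarrow> real^'n^'n \<Rightarrow> real^'n^'n" where
  "Gr_proj_deriv q A v =
    - (1/4) *\<^sub>R (v ** (A + transpose A) ** q + q ** (A + transpose A) ** v)"

lemma linear_Gr_proj: "linear (Gr_proj q)"
  by (intro linearI)
    (simp_all add: Gr_proj_def transpose_simps matrix_mult_simps algebra_simps)

lemma Gr_proj_tangent:
  assumes q: "q \<in> Gr k"
  shows "Gr_proj q A \<in> tangent_space (Gr k) q"
proof -
  define S where "S = A + transpose A"
  have S: "transpose S = S" by (simp add: S_def transpose_simps add.commute)
  have "q ** (q ** S ** q) = S ** q" "q ** S ** q ** q = q ** S"
    using q by (simp_all add: Gr_iff matrix_mul_assoc[symmetric] matrix_mult_cancel_left)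
  then show ?thesis
    using q by (simp add: tangent_space_Gr Gr_iff Gr_proj_def S_def[symmetric] S transpose_simps
        matrix_mult_simps matrix_mul_assoc scaleR_diff_right)
qed

lemma tangent_space_GrD:
  assumes "q \<in> Gr k" "v \<in> tangent_space (Gr k) q"
  shows "transpose v = v" "q ** v = - (v ** q)" "q ** v ** q = - v"
proof -
  show "transpose v = v" and a: "q ** v = - (v ** q)"
    using assms by (auto simp: tangent_space_Gr)
  show "q ** v ** q = - v"
    using assms(1) by (simp add: a Gr_iff matrix_mult_simps matrix_mul_assoc[symmetric])
qed

lemma Gr_proj_of_tangent:
  assumes "q \<in> Gr k" "v \<in> tangent_space (Gr k) q"
  shows "Gr_proj q v = v"
proof -
  have "q ** (v + v) ** q = - (v + v)"
    by (simp only: matrix_add_ldistrib matrix_add_rdistrib tangent_space_GrD(3)[OF assms]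
        minus_add_distrib)
  then have "Gr_proj q v = (1/4) *\<^sub>R (v + v - - (v + v))"
    by (simp only: Gr_proj_def tangent_space_GrD[OF assms])
  then show ?thesis
    by (simp add: vec_eq_iff)
qed

text \<open>Transposition and the map S to qSq are self-adjoint, and on the tangent vector
  \<open>v\<close> they act as 1 and -1. Each of the four terms of the projection therefore
  contributes a quarter of the inner product.\<close>

lemma inner_Gr_proj:
  assumes "q \<in> Gr k" "v \<in> tangent_space (Gr k) q"
  shows "Gr_proj q A \<bullet> v = A \<bullet> v"
proof -
  have "(q ** S ** q) \<bullet> v = - (S \<bullet> v)" for S
  proof -
    have q: "transpose q = q" using assms(1) by (simp add: Gr_iff)
    have "(q ** S ** q) \<bullet> v = (q ** S) \<bullet> (v ** q)"
      by (simp only: inner_matrix_mult_right q)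
    also have "\<dots> = S \<bullet> (q ** v ** q)"
      by (simp only: inner_matrix_mult_left q matrix_mul_assoc)
    finally have "(q ** S ** q) \<bullet> v = S \<bullet> (q ** v ** q)" .
    then show ?thesis by (simp add: tangent_space_GrD(3)[OF assms])
  qed
  moreover have "transpose A \<bullet> v = A \<bullet> v"
    using inner_transpose[of A v] tangent_space_GrD[OF assms] by simp
  ultimately show ?thesis
    by (simp add: Gr_proj_def inner_simps)
qed

lemma has_derivative_Gr_proj:
  "((\<lambda>q. Gr_proj q A) has_derivative Gr_proj_deriv q A) (at q)"
  unfolding Gr_proj_def
  by (rule has_derivative_eq_rhs[OF has_derivative_scaleR_right[OF has_derivative_diff[OF
          has_derivative_const bounded_bilinear.FDERIV[OF bounded_bilinear_matrix_mult
            bounded_linear.has_derivative[OF bounded_linear_matrix_mult_left has_derivative_ident]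
            has_derivative_ident]]]])
    (simp add: fun_eq_iff Gr_proj_deriv_def algebra_simps)

lemma smooth_on_Gr_proj:
  assumes "open S" "smooth_on S c"
  shows "smooth_on S (\<lambda>x. Gr_proj (c x) A)"
  unfolding Gr_proj_def
  by (intro smooth_on_bounded_linear[OF bounded_linear_scaleR_right] smooth_on_diff smooth_on_const
      smooth_on_bounded_bilinear[OF bounded_bilinear_matrix_mult]
      smooth_on_bounded_linear[OF bounded_linear_matrix_mult_left] assms)

lemma Gr_proj_vector_field: "(\<lambda>q. Gr_proj q A) \<in> vector_fields (Gr k)"
  unfolding vector_fields_def
  by (auto intro: smooth_on_mfdI Gr_proj_tangent
      smooth_on_Gr_proj[OF open_UNIV smooth_on_id[OF open_UNIV]])

section \<open>The Levi-Civita connection and covariant derivative of the Grassmannian\<close>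

lemma subspace_tangent_space_Gr:
  assumes "q \<in> Gr k" shows "subspace (tangent_space (Gr k) q)"
  unfolding tangent_space_Gr[OF assms]
  by (rule subspaceI) (simp_all add: transpose_simps matrix_mult_simps
      linear_0[OF bounded_linear.linear[OF bounded_linear_transpose]])

text \<open>The uniqueness argument for the Levi-Civita connection, run on the projected constant
  fields. \<open>D E F\<close> is the ambient derivative of the second field along the first, and
  \<open>T\<close> is the defect to be shown zero.\<close>

lemma levi_civita_Gr_proj:
  assumes lc: "levi_civita_connection (Gr k) Gr_metric nabla" and p: "p \<in> Gr k"
  shows "nabla (\<lambda>q. Gr_proj q E) (\<lambda>q. Gr_proj q F) p =
    Gr_proj p (Gr_proj_deriv p F (Gr_proj p E))"
proof -
  define N where "N E F = nabla (\<lambda>q. Gr_proj q E) (\<lambda>q. Gr_proj q F) p" for E F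
  define D where "D E F = Gr_proj_deriv p F (Gr_proj p E)" for E F
  define T where "T E F = N E F - Gr_proj p (D E F)" for E F
  let ?T = "tangent_space (Gr k) p"
  note sub = subspace_tangent_space_Gr[OF p]
  have N: "N E F \<in> ?T" for E F
  proof -
    have "nabla (\<lambda>q. Gr_proj q E) (\<lambda>q. Gr_proj q F) \<in> vector_fields (Gr k)"
      using lc Gr_proj_vector_field
      unfolding levi_civita_connection_def affine_connection_def by blast
    then show ?thesis using p by (simp add: vector_fields_def N_def)
  qed
  then have T: "T E F \<in> ?T" for E F
    using Gr_proj_tangent[OF p] subspace_diff[OF sub] by (auto simp: T_def)
  \<comment> \<open>The linear functions \<open>q \<bullet> b\<close> read off ambient coordinates,
    so testing on them turns the torsion identity between derivations into one between
    vectors.\<close>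
  have lin: "dir_deriv (Gr k) (\<lambda>q. q \<bullet> b) q v = v \<bullet> b"
    if "q \<in> Gr k" "v \<in> tangent_space (Gr k) q" for q v and b :: "real^'a^'a"
    by (rule dir_deriv_eqI[OF that(2) refl]) (auto intro!: derivative_eq_intros)
  have lin2: "dir_deriv (Gr k) (\<lambda>q. dir_deriv (Gr k) (\<lambda>q. q \<bullet> b) q (Gr_proj q F)) p (Gr_proj p E)
      = D E F \<bullet> b" for E F b
    unfolding D_def
    by (rule dir_deriv_eqI[OF Gr_proj_tangent[OF p], where H = "\<lambda>q. Gr_proj q F \<bullet> b"])
      (auto simp: lin Gr_proj_tangent intro!: has_derivative_inner_left has_derivative_Gr_proj)
  have torsion: "N E F - N F E = D E F - D F E" for E F
  proof (rule vector_eq_rdot[THEN iffD1], rule allI)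
    fix b
    have "smooth_on_mfd (Gr k) (\<lambda>q :: real^'a^'a. q \<bullet> b)"
      by (intro smooth_on_mfdI smooth_on_bounded_linear[OF bounded_linear_inner_left] smooth_on_id)
        auto
    then have "dir_deriv (Gr k) (\<lambda>q. q \<bullet> b) p (N E F - N F E) = D E F \<bullet> b - D F E \<bullet> b"
      using lc p Gr_proj_vector_field
      unfolding levi_civita_connection_def torsion_free_def lin2[symmetric] N_def by blast
    then show "(N E F - N F E) \<bullet> b = (D E F - D F E) \<bullet> b"
      using lin[OF p subspace_diff[OF sub N N]] by (simp add: inner_diff_left)
  qed
  have sym: "T E F = T F E" for E F
  proof -
    \<comment> \<open>Projecting the torsion identity leaves its left side unchanged, since that is
      tangent, and makes the right side tangential.\<close>
    have "Gr_proj p (N E F - N F E) = Gr_proj p (D E F) - Gr_proj p (D F E)"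
      by (simp add: torsion linear_diff[OF linear_Gr_proj])
    then have "N E F - N F E = Gr_proj p (D E F) - Gr_proj p (D F E)"
      using Gr_proj_of_tangent[OF p subspace_diff[OF sub N N]] by simp
    then show ?thesis by (simp add: T_def algebra_simps)
  qed
  have tr: "trace (A ** Gr_proj p G) = A \<bullet> Gr_proj p G" for A G
    by (simp add: trace_mult_eq_inner tangent_space_GrD(1)[OF p Gr_proj_tangent[OF p]])
  then have tr': "trace (Gr_proj p G ** A) = A \<bullet> Gr_proj p G" for A G
    by (metis trace_mul_sym)
  \<comment> \<open>The derivative of the metric is computed twice, by the ambient product rule and
    by metric compatibility. Pairing with a tangent vector does not see the projection in
    \<open>T\<close>, so the difference of the two results is the skew symmetry.\<close>
  have skew: "T E F \<bullet> Gr_proj p G = - (T E G \<bullet> Gr_proj p F)" for E F G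
  proof -
    have "bounded_linear (trace :: real^'a^'a \<Rightarrow> real)"
      by (intro linear_conv_bounded_linear[THEN iffD1] linearI)
        (simp_all add: trace_add, simp add: trace_def sum_distrib_left)
    note der = bounded_linear.has_derivative[OF this bounded_bilinear.FDERIV[OF
          bounded_bilinear_matrix_mult has_derivative_Gr_proj has_derivative_Gr_proj]]
    have "dir_deriv (Gr k) (\<lambda>q. Gr_metric q (Gr_proj q F) (Gr_proj q G)) p (Gr_proj p E)
        = trace (Gr_proj p F ** D E G + D E F ** Gr_proj p G)"
      unfolding D_def
      by (rule dir_deriv_eqI[OF Gr_proj_tangent[OF p] _ der]) (simp add: Gr_metric_def)
    moreover have "dir_deriv (Gr k) (\<lambda>q. Gr_metric q (Gr_proj q F) (Gr_proj q G)) p (Gr_proj p E)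
        = trace (N E F ** Gr_proj p G) + trace (Gr_proj p F ** N E G)"
    proof -
      have "metric_compatible (Gr k) Gr_metric nabla"
        using lc by (simp add: levi_civita_connection_def)
      from this[unfolded metric_compatible_def, rule_format, OF Gr_proj_vector_field[of E]
          Gr_proj_vector_field[of F] Gr_proj_vector_field[of G] p]
      show ?thesis by (simp add: Gr_metric_def N_def)
    qed
    ultimately have "N E F \<bullet> Gr_proj p G + N E G \<bullet> Gr_proj p F =
        D E F \<bullet> Gr_proj p G + D E G \<bullet> Gr_proj p F"
      by (simp add: trace_add tr tr')
    then show ?thesis
      by (simp add: T_def inner_diff_left inner_Gr_proj[OF p Gr_proj_tangent[OF p]])
  qed
  txt \<open>A trilinear form that is symmetric in its first two and skew in its last two arguments
    vanishes.\<close>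
  have "T E F \<bullet> Gr_proj p G = 0" for G
    using skew[of E F G] skew[of G E F] skew[of F G E] sym[of E G] sym[of G F] sym[of F E] by simp
  \<comment> \<open>\<open>T E F\<close> is tangent, so it equals its own projection and the pairing
    becomes its squared norm.\<close>
  from this[of "T E F"] show ?thesis
    by (simp add: Gr_proj_of_tangent[OF p T]) (simp add: T_def N_def D_def)
qed

text \<open>Turns the abstract operator \<open>D\<close> into a matrix formula. The value does not
  mention \<open>D\<close>, so any two covariant derivatives agree on fields along the
  curve.\<close>

lemma covariant_derivative_along_Gr:
  assumes lc: "levi_civita_connection (Gr k) Gr_metric nabla"
    and J: "open J" and curve: "curve_on (Gr k) J \<gamma>"
    and vel: "velocity \<gamma> \<in> fields_along (Gr k) J \<gamma>"
    and D: "covariant_derivative_along (Gr k) nabla J \<gamma> D"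
    and W: "W \<in> fields_along (Gr k) J \<gamma>" and t: "t \<in> J"
  shows "D W t = Gr_proj (\<gamma> t) (velocity W t)"
proof -
  let ?F = "fields_along (Gr k) J \<gamma>"
  have \<gamma>: "smooth_on J \<gamma>" "\<And>s. s \<in> J \<Longrightarrow> \<gamma> s \<in> Gr k"
    using curve unfolding curve_on_def by auto
  have sub: "subspace (tangent_space (Gr k) (\<gamma> s))" if "s \<in> J" for s
    using \<gamma>(2)[OF that] by (rule subspace_tangent_space_Gr)
  have add: "(\<lambda>s. Z s + Z' s) \<in> ?F" if "Z \<in> ?F" "Z' \<in> ?F" for Z Z'
    using that J sub by (auto simp: fields_along_def intro: smooth_on_add subspace_add)
  have mult: "(\<lambda>s. f s *\<^sub>R Z s) \<in> ?F" if "smooth_on J f" "Z \<in> ?F" for f Z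
    using that J sub
    using smooth_on_bounded_bilinear[OF bounded_bilinear_scaleR J that(1), of Z]
    by (auto simp: fields_along_def intro: subspace_scale)
  have D_lin: "D (\<lambda>s. a *\<^sub>R Z s + b *\<^sub>R Z' s) t = a *\<^sub>R D Z t + b *\<^sub>R D Z' t"
    if "Z \<in> ?F" "Z' \<in> ?F" for a b Z Z'
    using D that t unfolding covariant_derivative_along_def by blast
  have D_mult: "D (\<lambda>s. f s *\<^sub>R Z s) t = velocity f t *\<^sub>R Z t + f t *\<^sub>R D Z t"
    if "smooth_on J f" "Z \<in> ?F" for f Z
    using D that t unfolding covariant_derivative_along_def by blast
  \<comment> \<open>The last clause on \<open>D\<close> asks for a global field with the value
    \<open>velocity \<gamma> t\<close> at the point \<open>\<gamma> t\<close>; projecting this one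
    matrix at every point produces it.\<close>
  define X where "X q = Gr_proj q (velocity \<gamma> t)" for q
  have X: "X \<in> vector_fields (Gr k)" "X (\<gamma> t) = velocity \<gamma> t"
    using Gr_proj_vector_field[of "velocity \<gamma> t" k] vel Gr_proj_of_tangent[OF \<gamma>(2)[OF t]] t
    by (auto simp: X_def[abs_def] fields_along_def)
  have D_nabla: "D Z t = nabla X Y (\<gamma> t)"
    if "Y \<in> vector_fields (Gr k)" "Z \<in> ?F" "\<And>s. s \<in> J \<Longrightarrow> Z s = Y (\<gamma> s)" for Y Z
    using D that t X unfolding covariant_derivative_along_def by blast
  define P where "P b s = Gr_proj (\<gamma> s) b" for b s
  have P: "P b \<in> ?F" for b
    using \<gamma> J by (auto simp: fields_along_def P_def[abs_def] smooth_on_Gr_proj Gr_proj_tangent)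
  have P': "(P b has_vector_derivative Gr_proj_deriv (\<gamma> t) b (velocity \<gamma> t)) (at t)" for b
    using vector_derivative_diff_chain_within[OF smooth_on_has_vector_derivative[OF \<gamma>(1) t]
        has_derivative_at_withinI[OF has_derivative_Gr_proj]]
    by (simp add: P_def[abs_def] o_def)
  have DP: "D (P b) t = Gr_proj (\<gamma> t) (velocity (P b) t)" for b
    using D_nabla[OF Gr_proj_vector_field P, of b b] levi_civita_Gr_proj[OF lc \<gamma>(2)[OF t]] X(2)
    by (simp add: P_def vector_derivative_at[OF P'] X_def[abs_def])
  have Ws: "smooth_on J W" "\<And>s. s \<in> J \<Longrightarrow> W s \<in> tangent_space (Gr k) (\<gamma> s)"
    using W by (auto simp: fields_along_def)
  have coord: "smooth_on J (\<lambda>s. W s \<bullet> b)" for b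
    by (intro smooth_on_bounded_linear[OF bounded_linear_inner_left] J Ws)
  have coord': "((\<lambda>s. W s \<bullet> b) has_vector_derivative velocity (\<lambda>s. W s \<bullet> b) t) (at t)" for b
    by (rule smooth_on_has_vector_derivative[OF coord t])
  \<comment> \<open>Partial sums of the coordinate expansion of \<open>W\<close>, over sets of basis
    matrices, so that the binary linearity of \<open>D\<close> can be iterated by induction.\<close>
  define g where "g I s = (\<Sum>b\<in>I. (W s \<bullet> b) *\<^sub>R P b s)" for I s
  have g: "g I \<in> ?F \<and> D (g I) t = Gr_proj (\<gamma> t) (velocity (g I) t)" if "finite I" for I
    using that
  proof (induction I)
    case empty
    have "D (\<lambda>s. 0) t = 0" "(\<lambda>s. 0) \<in> ?F"
      using D_lin[OF W W, of 0 0] mult[OF smooth_on_const W, of 0] by simp_all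
    then show ?case by (simp add: g_def[abs_def] linear_0[OF linear_Gr_proj])
  next
    case (insert b I)
    let ?h = "\<lambda>s. (W s \<bullet> b) *\<^sub>R P b s"
    have eq: "g (insert b I) = (\<lambda>s. ?h s + g I s)"
      using insert.hyps by (simp add: g_def fun_eq_iff)
    have h: "?h \<in> ?F" by (rule mult[OF coord P])
    have h': "(?h has_vector_derivative
        (W t \<bullet> b) *\<^sub>R velocity (P b) t + velocity (\<lambda>s. W s \<bullet> b) t *\<^sub>R P b t) (at t)"
      using bounded_bilinear.has_vector_derivative[OF bounded_bilinear_scaleR coord' P']
      by (simp add: vector_derivative_at[OF P'])
    have g': "(g I has_vector_derivative velocity (g I) t) (at t)"
      using insert.IH t smooth_on_has_vector_derivative by (auto simp: fields_along_def)
    \<comment> \<open>The product rule leaves a term with a differentiated coefficient and an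
      undifferentiated \<open>P b t\<close>; being tangent, it passes through the projection
      unchanged.\<close>
    have PP: "Gr_proj (\<gamma> t) (P b t) = P b t"
      unfolding P_def by (intro Gr_proj_of_tangent[OF \<gamma>(2)[OF t]] Gr_proj_tangent \<gamma>(2) t)
    have "D (\<lambda>s. ?h s + g I s) t = D ?h t + D (g I) t"
      using D_lin[OF h, of "g I" 1 1] insert.IH by simp
    also have "\<dots> = Gr_proj (\<gamma> t) ((W t \<bullet> b) *\<^sub>R velocity (P b) t
        + velocity (\<lambda>s. W s \<bullet> b) t *\<^sub>R P b t + velocity (g I) t)"
      using insert.IH
      by (simp add: D_mult[OF coord P] DP linear_add[OF linear_Gr_proj]
          linear_scale[OF linear_Gr_proj] PP)
    also have "\<dots> = Gr_proj (\<gamma> t) (velocity (\<lambda>s. ?h s + g I s) t)"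
      using vector_derivative_at[OF has_vector_derivative_add[OF h' g']] by simp
    finally show ?case using add[OF h] insert.IH by (simp add: eq)
  qed
  let ?g = "g Basis"
  \<comment> \<open>Projecting the expansion of \<open>W s\<close> in the standard basis returns
    \<open>W s\<close>, by tangency.\<close>
  have gW: "?g s = W s" if "s \<in> J" for s
  proof -
    have "?g s = Gr_proj (\<gamma> s) (\<Sum>b\<in>Basis. (W s \<bullet> b) *\<^sub>R b)"
      by (simp add: g_def P_def linear_sum[OF linear_Gr_proj] linear_scale[OF linear_Gr_proj])
    then show ?thesis
      using Gr_proj_of_tangent[OF \<gamma>(2) Ws(2), OF that that] by (simp add: euclidean_representation)
  qed
  txt \<open>An operator on total functions need not be local a priori: \<open>D W\<close> and \<open>D ?g\<close> are compared
    through the restriction of the zero vector field.\<close>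
  have zero: "(\<lambda>_. 0) \<in> vector_fields (Gr k)"
    by (auto simp: vector_fields_def subspace_0[OF subspace_tangent_space_Gr]
        intro: smooth_on_mfdI smooth_on_const)
  have "nabla X (\<lambda>q. a *\<^sub>R Y q + b *\<^sub>R Y q) (\<gamma> t) = a *\<^sub>R nabla X Y (\<gamma> t) + b *\<^sub>R nabla X Y (\<gamma> t)"
    if "Y \<in> vector_fields (Gr k)" for a b Y
    using lc X(1) that \<gamma>(2)[OF t] unfolding levi_civita_connection_def affine_connection_def by blast
  from this[OF zero, of 0 0] have "nabla X (\<lambda>_. 0) (\<gamma> t) = 0" by simp
  moreover have "D (\<lambda>s. 1 *\<^sub>R W s + (-1) *\<^sub>R ?g s) t = nabla X (\<lambda>_. 0) (\<gamma> t)"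
    by (rule D_nabla[OF zero])
      (use gW add[OF W mult[OF smooth_on_const, of ?g "-1"]] g in auto)
  ultimately have "D W t = D ?g t"
    using D_lin[OF W, of ?g 1 "-1"] g by simp
  moreover have "velocity ?g t = velocity W t"
  proof (rule vector_derivative_at)
    show "(?g has_vector_derivative velocity W t) (at t)"
      by (rule has_vector_derivative_transform_within_open[OF
            smooth_on_has_vector_derivative[OF Ws(1) t] J t]) (simp add: gW)
  qed
  ultimately show ?thesis using g by simp
qed

section \<open>Geodesics and parallel transport\<close>

text \<open>Conservation of \<open>velocity \<gamma> s ** \<gamma> s\<close> lowers the second-order
  equation to a first-order linear one, solved by \<open>conj_flow\<close>.\<close>

lemma geodesic_Gr_eq_conj_flow:
  assumes lc: "levi_civita_connection (Gr k) Gr_metric nabla"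
    and J: "open J" "is_interval J" "0 \<in> J"
    and geo: "geodesic (Gr k) nabla J \<gamma>" and t: "t \<in> J"
  defines "A \<equiv> (1/2) *\<^sub>R (velocity \<gamma> 0 ** \<gamma> 0)"
  shows "\<gamma> t = conj_flow A (\<gamma> 0) t"
proof -
  have curve: "curve_on (Gr k) J \<gamma>" and vel: "velocity \<gamma> \<in> fields_along (Gr k) J \<gamma>"
    using geo by (auto simp: geodesic_def parallel_along_def)
  have \<gamma>: "smooth_on J \<gamma>" "\<gamma> s \<in> Gr k" if "s \<in> J" for s
    using curve that unfolding curve_on_def by auto
  have inv: "\<gamma> s ** \<gamma> s = mat 1" if "s \<in> J" for s
    using \<gamma>(2)[OF that] by (simp add: Gr_iff)
  have d\<gamma>: "(\<gamma> has_vector_derivative velocity \<gamma> s) (at s)" if "s \<in> J" for s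
    by (rule smooth_on_has_vector_derivative[OF \<gamma>(1) that]) (use that in auto)
  have vt: "velocity \<gamma> s \<in> tangent_space (Gr k) (\<gamma> s)" if "s \<in> J" for s
    using vel that by (auto simp: fields_along_def)
  note vtD = tangent_space_GrD[OF \<gamma>(2) vt]
  define acc where "acc = velocity (velocity \<gamma>)"
  have dv: "(velocity \<gamma> has_vector_derivative acc s) (at s)" if "s \<in> J" for s
    unfolding acc_def using vel that smooth_on_has_vector_derivative
    by (auto simp: fields_along_def)
  have convex: "convex J" using J(2) by (simp add: is_interval_convex)
  txt \<open>Differentiating \<open>\<gamma>\<^sup>2 = 1\<close> twice turns the geodesic equation into
    \<open>\<gamma>'' \<gamma> + \<gamma>'\<^sup>2 = 0\<close>, the derivative of \<open>\<gamma>' \<gamma>\<close>.\<close>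
  have acc: "acc s ** \<gamma> s + velocity \<gamma> s ** velocity \<gamma> s = 0" if s: "s \<in> J" for s
  proof -
    have sym: "transpose (acc s) = acc s"
    proof (rule vector_derivative_unique_at[OF _ dv[OF s]])
      show "(velocity \<gamma> has_vector_derivative transpose (acc s)) (at s)"
        by (rule has_vector_derivative_transform_within_open[OF
              bounded_linear.has_vector_derivative[OF bounded_linear_transpose dv[OF s]] J(1) s])
          (simp add: vtD)
    qed
    obtain D where D: "covariant_derivative_along (Gr k) nabla J \<gamma> D" "D (velocity \<gamma>) s = 0"
      using geo s unfolding geodesic_def parallel_along_def by blast
    have "Gr_proj (\<gamma> s) (acc s) = 0"
      using covariant_derivative_along_Gr[OF lc J(1) curve vel D(1) vel s] D(2)
      by (simp add: acc_def)
    \<comment> \<open>For a symmetric matrix, a vanishing projection means invariance under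
      conjugation by \<open>\<gamma> s\<close>; hence the acceleration commutes with
      \<open>\<gamma> s\<close>.\<close>
    then have "acc s + acc s = \<gamma> s ** (acc s + acc s) ** \<gamma> s"
      by (simp only: Gr_proj_def sym) simp
    then have "2 *\<^sub>R acc s = 2 *\<^sub>R (\<gamma> s ** acc s ** \<gamma> s)"
      by (simp only: matrix_mult_simps scaleR_2)
    then have eq: "acc s = \<gamma> s ** acc s ** \<gamma> s" by simp
    have eq': "acc s ** \<gamma> s = \<gamma> s ** acc s"
      by (subst eq) (simp add: matrix_mul_assoc[symmetric] inv[OF s])
    have "((\<lambda>u. velocity \<gamma> u ** \<gamma> u + \<gamma> u ** velocity \<gamma> u) has_vector_derivative
       (velocity \<gamma> s ** velocity \<gamma> s + acc s ** \<gamma> s) + (\<gamma> s ** acc s + velocity \<gamma> s ** velocity \<gamma> s)) (at s)"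
      by (intro has_vector_derivative_add has_vector_derivative_matrix_mult dv d\<gamma> s)
    moreover have "((\<lambda>u. velocity \<gamma> u ** \<gamma> u + \<gamma> u ** velocity \<gamma> u) has_vector_derivative 0) (at s)"
      by (rule has_vector_derivative_transform_within_open[OF has_vector_derivative_const[of 0] J(1) s])
        (simp add: vtD)
    ultimately have "(velocity \<gamma> s ** velocity \<gamma> s + acc s ** \<gamma> s) +
        (\<gamma> s ** acc s + velocity \<gamma> s ** velocity \<gamma> s) = 0"
      by (rule vector_derivative_unique_at)
    then have "2 *\<^sub>R (acc s ** \<gamma> s + velocity \<gamma> s ** velocity \<gamma> s) = 0"
      unfolding scaleR_2 eq'[symmetric] by (simp only: add_ac)
    then show ?thesis by simp
  qed
  have "((\<lambda>s. velocity \<gamma> s ** \<gamma> s) has_vector_derivative 0) (at s within J)" if "s \<in> J" for s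
    by (rule has_vector_derivative_at_within, rule has_vector_derivative_eq_rhs[OF
          has_vector_derivative_matrix_mult[OF dv[OF that] d\<gamma>[OF that]]])
      (use acc[OF that] in \<open>simp add: add.commute\<close>)
  then obtain \<Omega> where "\<And>s. s \<in> J \<Longrightarrow> velocity \<gamma> s ** \<gamma> s = \<Omega>"
    using has_vector_derivative_zero_constant[OF convex, of "\<lambda>s. velocity \<gamma> s ** \<gamma> s"] by auto
  then have \<Omega>: "velocity \<gamma> s ** \<gamma> s = 2 *\<^sub>R A" if "s \<in> J" for s
    using that J(3) by (simp add: A_def)
  \<comment> \<open>The conserved quantity identifies \<open>A\<close> at every time
    \<open>s\<close>, so the commutator that recovered \<open>v\<close> in
    \<open>tangent_space_Gr\<close> now recovers the velocity all along the curve.\<close>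
  have "velocity \<gamma> s = A ** \<gamma> s - \<gamma> s ** A" if s: "s \<in> J" for s
  proof -
    have "A = (1/2) *\<^sub>R (velocity \<gamma> s ** \<gamma> s)" using \<Omega>[OF s] by simp
    then have "A ** \<gamma> s - \<gamma> s ** A =
        (1/2) *\<^sub>R (velocity \<gamma> s ** (\<gamma> s ** \<gamma> s)) - (1/2) *\<^sub>R (\<gamma> s ** velocity \<gamma> s ** \<gamma> s)"
      by (simp add: matrix_mult_simps matrix_mul_assoc)
    then show ?thesis
      unfolding vtD(3)[OF s s] by (simp add: inv[OF s] flip: scaleR_add_left)
  qed
  then have d\<gamma>': "(\<gamma> has_vector_derivative A ** \<gamma> s - \<gamma> s ** A) (at s)" if "s \<in> J" for s
    using d\<gamma>[OF that] that by simp
  \<comment> \<open>Undoing the expected conjugation must leave a constant; its value at 0 is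
    \<open>\<gamma> 0\<close>.\<close>
  have "((\<lambda>s. mat_exp (s *\<^sub>R (- A)) ** \<gamma> s ** mat_exp (s *\<^sub>R A)) has_vector_derivative 0)
      (at s within J)" if "s \<in> J" for s
    by (rule has_vector_derivative_at_within, rule has_vector_derivative_eq_rhs[OF
          has_vector_derivative_matrix_mult[OF has_vector_derivative_matrix_mult[OF
              has_vector_derivative_mat_exp_minus d\<gamma>'[OF that]] has_vector_derivative_mat_exp]])
      (simp add: matrix_mult_simps matrix_mul_assoc)
  then obtain c where c: "\<And>s. s \<in> J \<Longrightarrow> mat_exp (s *\<^sub>R (- A)) ** \<gamma> s ** mat_exp (s *\<^sub>R A) = c"
    using has_vector_derivative_zero_constant[OF convex,
        of "\<lambda>s. mat_exp (s *\<^sub>R (- A)) ** \<gamma> s ** mat_exp (s *\<^sub>R A)"] by auto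
  have "c = \<gamma> 0" using c[OF J(3)] by simp
  with c[OF t] have "conj_flow A (\<gamma> 0) t = mat_exp (t *\<^sub>R A) **
      (mat_exp (t *\<^sub>R (- A)) ** \<gamma> t ** mat_exp (t *\<^sub>R A)) ** mat_exp (t *\<^sub>R (- A))"
    by (simp add: conj_flow_def)
  also have "\<dots> = (mat_exp (t *\<^sub>R A) ** mat_exp (t *\<^sub>R (- A))) ** \<gamma> t **
      (mat_exp (t *\<^sub>R A) ** mat_exp (t *\<^sub>R (- A)))"
    by (simp only: matrix_mul_assoc)
  finally show ?thesis by (simp only: mat_exp_mult_minus matrix_mul_lid matrix_mul_rid)
qed

text \<open>The two fields may be parallel for different witnesses \<open>D\<close>, but the
  projection formula makes both conditions say that the derivative is normal. The difference is
  tangent with normal derivative, so its squared norm stays at its initial value 0.\<close>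

lemma parallel_along_Gr_unique:
  assumes lc: "levi_civita_connection (Gr k) Gr_metric nabla"
    and J: "open J" "is_interval J" "0 \<in> J"
    and curve: "curve_on (Gr k) J \<gamma>" and vel: "velocity \<gamma> \<in> fields_along (Gr k) J \<gamma>"
    and Z: "parallel_along (Gr k) nabla J \<gamma> Z" and W: "parallel_along (Gr k) nabla J \<gamma> W"
    and "W 0 = Z 0" and t: "t \<in> J"
  shows "W t = Z t"
proof -
  have F: "U \<in> fields_along (Gr k) J \<gamma>" if "parallel_along (Gr k) nabla J \<gamma> U" for U
    using that by (simp add: parallel_along_def)
  have der: "(U has_vector_derivative velocity U s) (at s)"
    if "parallel_along (Gr k) nabla J \<gamma> U" "s \<in> J" for U s
    using F[OF that(1)] that(2) smooth_on_has_vector_derivative by (auto simp: fields_along_def)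
  have proj: "Gr_proj (\<gamma> s) (velocity U s) = 0"
    if U: "parallel_along (Gr k) nabla J \<gamma> U" and s: "s \<in> J" for U s
  proof -
    obtain D where "covariant_derivative_along (Gr k) nabla J \<gamma> D" "D U s = 0"
      using U s unfolding parallel_along_def by blast
    then show ?thesis
      using covariant_derivative_along_Gr[OF lc J(1) curve vel _ F[OF U] s] by simp
  qed
  let ?d = "\<lambda>s. W s - Z s"
  have "((\<lambda>s. ?d s \<bullet> ?d s) has_vector_derivative 0) (at s within J)" if s: "s \<in> J" for s
  proof -
    let ?d' = "velocity W s - velocity Z s"
    have \<gamma>s: "\<gamma> s \<in> Gr k" using curve s unfolding curve_on_def by blast
    have "?d s \<in> tangent_space (Gr k) (\<gamma> s)"
      using F[OF Z] F[OF W] s subspace_diff[OF subspace_tangent_space_Gr[OF \<gamma>s]]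
      by (simp add: fields_along_def)
    then have "?d' \<bullet> ?d s = 0"
      using inner_Gr_proj[OF \<gamma>s, of "?d s" ?d'] proj[OF W s] proj[OF Z s]
      by (simp add: linear_diff[OF linear_Gr_proj])
    moreover have "((\<lambda>s. ?d s \<bullet> ?d s) has_vector_derivative ?d s \<bullet> ?d' + ?d' \<bullet> ?d s) (at s)"
      by (intro bounded_bilinear.has_vector_derivative[OF bounded_bilinear_inner]
          has_vector_derivative_diff der W Z s)
    ultimately show ?thesis
      by (simp add: inner_commute has_vector_derivative_at_within)
  qed
  moreover have "convex J" using J(2) by (simp add: is_interval_convex)
  ultimately obtain c where "\<And>s. s \<in> J \<Longrightarrow> ?d s \<bullet> ?d s = c"
    using has_vector_derivative_zero_constant[of J "\<lambda>s. ?d s \<bullet> ?d s"] by auto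
  from this[OF J(3)] this[OF t] \<open>W 0 = Z 0\<close> show ?thesis by simp
qed

lemma parallel_transport_Gr:
  assumes lc: "levi_civita_connection (Gr k) Gr_metric nabla"
    and J: "open J" "is_interval J" "0 \<in> J"
    and geo: "geodesic (Gr k) nabla J \<gamma>"
    and Y: "Y \<in> tangent_space (Gr k) (\<gamma> 0)"
  shows "is_parallel_transport (Gr k) nabla J \<gamma> Y
    (conj_flow ((1/2) *\<^sub>R (velocity \<gamma> 0 ** \<gamma> 0)) Y)"
proof -
  define A where "A = (1/2) *\<^sub>R (velocity \<gamma> 0 ** \<gamma> 0)"
  let ?Z = "conj_flow A Y"
  have curve: "curve_on (Gr k) J \<gamma>" and vel: "velocity \<gamma> \<in> fields_along (Gr k) J \<gamma>"
    using geo by (auto simp: geodesic_def parallel_along_def)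
  have \<gamma>_Gr: "\<gamma> s \<in> Gr k" if "s \<in> J" for s
    using curve that unfolding curve_on_def by auto
  have \<gamma>: "\<gamma> s = conj_flow A (\<gamma> 0) s" if "s \<in> J" for s
    unfolding A_def by (rule geodesic_Gr_eq_conj_flow[OF lc J geo that])
  note Q = \<gamma>_Gr[OF J(3)]
  have Q': "\<gamma> 0 ** \<gamma> 0 = mat 1" "transpose (\<gamma> 0) = \<gamma> 0" using Q by (simp_all add: Gr_iff)
  have "velocity \<gamma> 0 \<in> tangent_space (Gr k) (\<gamma> 0)"
    using vel J(3) by (simp add: fields_along_def)
  note X = tangent_space_GrD[OF Q this]
  have skew: "transpose A = - A" by (simp add: A_def transpose_simps X Q')
  have "\<gamma> 0 ** A = - (A ** \<gamma> 0)"
    by (simp add: A_def matrix_mult_simps matrix_mul_assoc X(3))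
      (simp add: matrix_mul_assoc[symmetric] Q')
  \<comment> \<open>The relation at time 0 is carried along by the flow, which fixes its own
    generator \<open>A\<close>.\<close>
  then have anti: "\<gamma> s ** A = - (A ** \<gamma> s)" if "s \<in> J" for s
    using conj_flow_mult[of A "\<gamma> 0" s A] conj_flow_mult[of A A s "\<gamma> 0"]
    by (simp add: \<gamma>[OF that] conj_flow_self conj_flow_minus)
  have tan: "?Z s \<in> tangent_space (Gr k) (\<gamma> s)" if "s \<in> J" for s
  proof -
    have "transpose (?Z s) = ?Z s"
      by (simp add: transpose_conj_flow[OF skew] tangent_space_GrD(1)[OF Q Y])
    moreover have "\<gamma> s ** ?Z s = - (?Z s ** \<gamma> s)"
      by (simp add: \<gamma>[OF that] conj_flow_mult tangent_space_GrD(2)[OF Q Y] conj_flow_minus)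
    ultimately show ?thesis by (simp add: tangent_space_Gr[OF \<gamma>_Gr[OF that]])
  qed
  have Z: "?Z \<in> fields_along (Gr k) J \<gamma>"
    using tan by (simp add: fields_along_def smooth_on_conj_flow[OF J(1)])
  \<comment> \<open>Parallelism of \<open>?Z\<close> calls for an existing covariant derivative; the
    one witnessing the geodesic serves again.\<close>
  obtain D where D: "covariant_derivative_along (Gr k) nabla J \<gamma> D"
    using geo unfolding geodesic_def parallel_along_def by blast
  have "D ?Z s = 0" if s: "s \<in> J" for s
  proof -
    \<comment> \<open>Both \<open>A\<close> and \<open>?Z s\<close> anticommute with
      \<open>\<gamma> s\<close>, so their products commute with it. Being also symmetric,
      \<open>?Z'\<close> is annihilated by the projection.\<close>
    let ?Z' = "A ** ?Z s - ?Z s ** A"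
    note Zs = tangent_space_GrD[OF \<gamma>_Gr[OF s] tan[OF s]]
    have "transpose ?Z' = ?Z'"
      by (simp add: transpose_simps Zs skew matrix_mult_simps)
    moreover have "\<gamma> s ** ?Z' ** \<gamma> s = ?Z'"
    proof -
      have "\<gamma> s ** (A ** ?Z s) ** \<gamma> s = (\<gamma> s ** A) ** ?Z s ** \<gamma> s"
        by (simp only: matrix_mul_assoc)
      also have "\<dots> = A ** - (\<gamma> s ** ?Z s ** \<gamma> s)"
        by (simp only: anti[OF s] matrix_minus_left matrix_minus_right matrix_mul_assoc)
      finally have "\<gamma> s ** (A ** ?Z s) ** \<gamma> s = A ** ?Z s"
        by (simp only: Zs(3) minus_minus)
      \<comment> \<open>The double negation exposes the right side of \<open>anti\<close>, which is
        then rewritten backwards.\<close>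
      moreover have "\<gamma> s ** (?Z s ** A) ** \<gamma> s = \<gamma> s ** ?Z s ** - (- (A ** \<gamma> s))"
        by (simp only: minus_minus matrix_mul_assoc)
      then have "\<gamma> s ** (?Z s ** A) ** \<gamma> s = - (\<gamma> s ** ?Z s ** \<gamma> s) ** A"
        by (simp only: anti[OF s, symmetric] matrix_minus_left matrix_minus_right matrix_mul_assoc)
      then have "\<gamma> s ** (?Z s ** A) ** \<gamma> s = ?Z s ** A"
        by (simp only: Zs(3) minus_minus)
      ultimately show ?thesis
        by (simp only: matrix_diff_ldistrib matrix_diff_rdistrib)
    qed
    ultimately have "Gr_proj (\<gamma> s) ?Z' = 0"
      by (simp only: Gr_proj_def matrix_add_ldistrib matrix_add_rdistrib) simp
    then show ?thesis
      using covariant_derivative_along_Gr[OF lc J(1) curve vel D Z s]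
      by (simp add: vector_derivative_at[OF has_vector_derivative_conj_flow])
  qed
  then have par: "parallel_along (Gr k) nabla J \<gamma> ?Z"
    using Z D unfolding parallel_along_def by blast
  have "is_parallel_transport (Gr k) nabla J \<gamma> Y ?Z"
    unfolding is_parallel_transport_def
  proof (intro conjI allI impI ballI)
    fix W s assume W: "parallel_along (Gr k) nabla J \<gamma> W \<and> W 0 = Y" and s: "s \<in> J"
    show "W s = ?Z s"
      by (rule parallel_along_Gr_unique[OF lc J curve vel par _ _ s]) (use W in simp_all)
  qed (use par in simp_all)
  then show ?thesis by (simp only: A_def)
qed

section \<open>Block matrices and the explicit transport formula\<close>

lemma index_pos_inject [simp]: "index_pos i = index_pos j \<longleftrightarrow> i = j"
proof -
  have "index_pos i < index_pos j" if "i < j" for i j :: "'a::{finite,linorder}"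
    unfolding index_pos_def using that by (intro psubset_card_mono) auto
  from this[of i j] this[of j i] show ?thesis
    by (cases i j rule: linorder_cases) auto
qed

text \<open>In the lower block both positions are at least \<open>k\<close>, so the truncated
  subtractions lose nothing, and equal positions mean equal indices.\<close>

lemma signature_matrix_nth:
  "signature_matrix k $ i $ j = (if i = j then if index_pos j < k then 1 else - 1 else 0)"
  unfolding signature_matrix_def block_matrix_def
  by (simp add: not_less eq_diff_iff)

text \<open>Multiplication on the right negates the columns from position \<open>k\<close> on. It
  turns the symmetric block matrix of a tangent vector into the skew generator of the
  rotation.\<close>

lemma off_diag_mult_signature_matrix:
  "off_diag k B C ** signature_matrix k = off_diag k (\<lambda>i j. - B i j) C"
proof -
  have "(M ** signature_matrix k) $ i $ j = M $ i $ j * (if index_pos j < k then 1 else - 1)"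
    for M :: "real^'a::{finite,linorder}^'a::{finite,linorder}" and i j
    by (simp add: matrix_matrix_mult_def signature_matrix_nth if_distrib[of "(*) _"] cong: if_cong)
  then show ?thesis
    by (simp add: vec_eq_iff off_diag_def block_matrix_def)
qed

lemma minus_off_diag: "- off_diag k B C = off_diag k (\<lambda>i j. - B i j) (\<lambda>i j. - C i j)"
  by (simp add: vec_eq_iff off_diag_def block_matrix_def)

theorem proposition4p8:
  fixes k :: nat
    and Q X Y V :: "real ^ 'n::{finite,linorder} ^ 'n::{finite,linorder}"
    and B C :: "nat \<Rightarrow> nat \<Rightarrow> real"
    and nabla :: "(real ^ 'n::{finite,linorder} ^ 'n::{finite,linorder} \<Rightarrow> real ^ 'n::{finite,linorder} ^ 'n::{finite,linorder}) \<Rightarrow> (real ^ 'n::{finite,linorder} ^ 'n::{finite,linorder} \<Rightarrow> real ^ 'n::{finite,linorder} ^ 'n::{finite,linorder}) \<Rightarrow>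
              real ^ 'n::{finite,linorder} ^ 'n::{finite,linorder} \<Rightarrow> real ^ 'n::{finite,linorder} ^ 'n::{finite,linorder}"
    and J :: "real set" and \<gamma> :: "real \<Rightarrow> real ^ 'n::{finite,linorder} ^ 'n::{finite,linorder}"
  assumes "1 \<le> k" and "k \<le> CARD('n)"
    and "levi_civita_connection (Gr k) Gr_metric nabla"
    and "Q \<in> Gr k" and "X \<in> tangent_space (Gr k) Q" and "Y \<in> tangent_space (Gr k) Q"
    and "orthogonal_matrix V"
    and "Q = V ** signature_matrix k ** transpose V"
    and "X = V ** off_diag k B (\<lambda>i j. B j i) ** transpose V"
    and "Y = V ** off_diag k C (\<lambda>i j. C j i) ** transpose V"
    and "open J" and "is_interval J" and "0 \<in> J"
    and "geodesic (Gr k) nabla J \<gamma>" and "\<gamma> 0 = Q" and "velocity \<gamma> 0 = X"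
  shows "is_parallel_transport (Gr k) nabla J \<gamma> Y
           (\<lambda>t. V ** mat_exp ((t / 2) *\<^sub>R off_diag k (\<lambda>i j. - B i j) (\<lambda>i j. B j i))
                  ** off_diag k C (\<lambda>i j. C j i)
                  ** mat_exp ((t / 2) *\<^sub>R off_diag k B (\<lambda>i j. - B j i)) ** transpose V)"
proof -
  let ?S = "off_diag k (\<lambda>i j. - B i j) (\<lambda>i j. B j i) :: real^'n::{finite,linorder}^'n::{finite,linorder}"
  have V: "transpose V ** V = mat 1" "V ** transpose V = mat 1"
    using \<open>orthogonal_matrix V\<close> by (auto simp: orthogonal_matrix_def)
  \<comment> \<open>The inner \<open>transpose V ** V\<close> cancels, so the generator, half of
    \<open>X ** Q\<close>, is half of \<open>?S\<close> conjugated by \<open>V\<close>; this is the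
    origin of \<open>t / 2\<close>.\<close>
  have "X ** Q = V ** (off_diag k B (\<lambda>i j. B j i) ** (transpose V ** V ** signature_matrix k)) ** transpose V"
    by (simp only: assms(8,9) matrix_mul_assoc)
  then have XQ: "X ** Q = V ** ?S ** transpose V"
    by (simp add: V off_diag_mult_signature_matrix)
  have S': "off_diag k B (\<lambda>i j. - B j i) = - ?S"
    by (simp add: minus_off_diag)
  have exp: "mat_exp (r *\<^sub>R (V ** M ** transpose V)) = V ** mat_exp (r *\<^sub>R M) ** transpose V" for r M
    using mat_exp_conj[OF V, of "r *\<^sub>R M"] by (simp add: matrix_mult_simps)
  have "conj_flow ((1/2) *\<^sub>R (X ** Q)) Y t =
      V ** mat_exp ((t / 2) *\<^sub>R ?S) ** off_diag k C (\<lambda>i j. C j i)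
        ** mat_exp ((t / 2) *\<^sub>R - ?S) ** transpose V" for t
  proof -
    have "conj_flow ((1/2) *\<^sub>R (X ** Q)) Y t =
        mat_exp ((t / 2) *\<^sub>R (V ** ?S ** transpose V)) ** Y ** mat_exp ((- t / 2) *\<^sub>R (V ** ?S ** transpose V))"
      by (simp add: conj_flow_def XQ)
    also have "\<dots> = V ** mat_exp ((t / 2) *\<^sub>R ?S) ** (transpose V ** V) ** off_diag k C (\<lambda>i j. C j i)
        ** (transpose V ** V) ** mat_exp ((- t / 2) *\<^sub>R ?S) ** transpose V"
      by (simp only: exp assms(10) matrix_mul_assoc)
    finally show ?thesis by (simp add: V)
  qed
  then have "conj_flow ((1/2) *\<^sub>R (X ** Q)) Y = (\<lambda>t. V ** mat_exp ((t / 2) *\<^sub>R ?S)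
      ** off_diag k C (\<lambda>i j. C j i) ** mat_exp ((t / 2) *\<^sub>R - ?S) ** transpose V)"
    by (rule ext)
  then show ?thesis
    unfolding S' using parallel_transport_Gr[OF assms(3,11-14), of Y] assms(6)
    by (simp only: assms(15,16))
qed

end
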